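(* Fix $k\in\mathbb Z_{\ge0}$ and an irreducible fraction $t\in(0,1)$, and put $w_{k,t}=\dfrac{u^+_{k,t}v^-_{k,t}+1}{m_{k,t}}$. Then (1) $M_t(k,0)=\begin{bmatrix}-v^-_{k,t}&m_{k,t}\\-w_{k,t}&u^+_{k,t}\end{bmatrix}$; (2) $C_t(k,-k)=\begin{bmatrix}u^+_{k,t}&m_{k,t}\\(3k+3)u^+_{k,t}-w_{k,t}&(3k+3)m_{k,t}-v^-_{k,t}\end{bmatrix}$.
   Context: Fix $k\in\mathbb Z_{\ge0}$. Farey tree $\mathrm{F}\mathbb T$: root $\left(\frac01,\frac11,\frac10\right)$; a vertex $\left(\frac ab,\frac cd,\frac ef\right)$ has left child $\left(\frac ab,\frac{a+c}{b+d},\frac cd\right)$ and right child $\left(\frac cd,\frac{c+e}{d+f},\frac ef\right)$; each positive irreducible fraction is the middle entry of exactly one vertex. $\mathrm{M}\mathbb T(k)$: root $(1,k+2,1)$; vertex $(a,b,c)$ has left child $\left(a,\frac{a^2+kab+b^2}{c},b\right)$ and right child $\left(b,\frac{b^2+kbc+c^2}{a},c\right)$. $\mathrm{MM}\mathbb T(k,0)$: root $\left(\begin{bmatrix}0&1\\-1&-k\end{bmatrix},\begin{bmatrix}-k-1&k+2\\-1&1\end{bmatrix},\begin{bmatrix}-k-1&1\\-k-2&1\end{bmatrix}\right)$; vertex $(X,Y,Z)$ has left child $(X,YZY^{-1},Y)$ and right child $(Y,Y^{-1}XY,Z)$. With $S=\begin{bmatrix}k&0\\3k^2+3k&k\end{bmatrix}$,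 $\mathrm{GC}\mathbb T(k,-k)$: root $\left(\begin{bmatrix}-k&1\\-3k^2-3k-1&3k+3\end{bmatrix},\begin{bmatrix}1&k+2\\3k+2&3k^2+8k+5\end{bmatrix},\begin{bmatrix}1&1\\2k+1&2k+2\end{bmatrix}\right)$; vertex $(P,Q,R)$ has left child $(P,PQ-S,Q)$ and right child $(Q,QR-S,R)$. For binary trees, "the corresponding vertex" refers to the unique bijection from $\mathrm{F}\mathbb T$ preserving the root and left/right children. For an irreducible $t>0$, $M_t(k,0)$ (resp. $C_t(k,-k)$) is the second component of the vertex of $\mathrm{MM}\mathbb T(k,0)$ (resp. $\mathrm{GC}\mathbb T(k,-k)$) corresponding to the vertex of $\mathrm{F}\mathbb T$ with middle entry $t$. For $t\in(0,1)$ with corresponding vertices $(r,t,s)\in\mathrm{F}\mathbb T$ and $(m_r,m_t,m_s)\in\mathrm{M}\mathbb T(k)$, set $m_{k,t}=m_t$; $u^+_{k,t}$ is the unique $x\in(0,m_t)$ with $m_rx\equiv m_s$, and $v^-_{k,t}$ the unique $x\in(0,m_t)$ with $m_sx\equiv -m_r\pmod{m_t}$. *)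

theory Defs
  imports "HOL-Analysis.Analysis" "HOL-Number_Theory.Cong"
begin

text \<open>
  A vertex of an infinite rooted binary tree is addressed by the list of turns leading to it from
  the root. The bijection between two such trees that preserves the root and left/right children
  is therefore equality of addresses.
\<close>

datatype turn = LeftTurn | RightTurn

fun child :: "('v \<Rightarrow> 'v) \<Rightarrow> ('v \<Rightarrow> 'v) \<Rightarrow> 'v \<Rightarrow> turn \<Rightarrow> 'v" where
  "child l r x LeftTurn = l x"
| "child l r x RightTurn = r x"

definition tree_vertex :: "'v \<Rightarrow> ('v \<Rightarrow> 'v) \<Rightarrow> ('v \<Rightarrow> 'v) \<Rightarrow> turn list \<Rightarrow> 'v" where
  "tree_vertex v l r p = foldl (child l r) v p"

fun second3 :: "'a \<times> 'a \<times> 'a \<Rightarrow> 'a" where "second3 (x, y, z) = y"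

text \<open>
  A formal fraction is a pair (numerator, denominator), so that 1/0 is allowed.
\<close>

type_synonym frac = "int \<times> int"

fun mediant :: "frac \<Rightarrow> frac \<Rightarrow> frac" where
  "mediant (a, b) (c, d) = (a + c, b + d)"

fun farey_left :: "frac \<times> frac \<times> frac \<Rightarrow> frac \<times> frac \<times> frac" where
  "farey_left (x, y, z) = (x, mediant x y, y)"

fun farey_right :: "frac \<times> frac \<times> frac \<Rightarrow> frac \<times> frac \<times> frac" where
  "farey_right (x, y, z) = (y, mediant y z, z)"

definition FT :: "turn list \<Rightarrow> frac \<times> frac \<times> frac" where
  "FT = tree_vertex ((0, 1), (1, 1), (1, 0)) farey_left farey_right"

text \<open>
  \<^const>\<open>quotient_of\<close> yields the irreducible representation with positive denominator.
\<close>

definition farey_address :: "rat \<Rightarrow> turn list" where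
  "farey_address t = (THE p. second3 (FT p) = quotient_of t)"

text \<open>
  The divisions below are exact at every vertex of the tree; see \<open>MT_exact\<close>.
\<close>

fun markov_left :: "int \<Rightarrow> int \<times> int \<times> int \<Rightarrow> int \<times> int \<times> int" where
  "markov_left k (a, b, c) = (a, (a\<^sup>2 + k * a * b + b\<^sup>2) div c, b)"

fun markov_right :: "int \<Rightarrow> int \<times> int \<times> int \<Rightarrow> int \<times> int \<times> int" where
  "markov_right k (a, b, c) = (b, (b\<^sup>2 + k * b * c + c\<^sup>2) div a, c)"

definition MT :: "int \<Rightarrow> turn list \<Rightarrow> int \<times> int \<times> int" where
  "MT k = tree_vertex (1, k + 2, 1) (markov_left k) (markov_right k)"

lemma markov_step:
  fixes a b c k :: int
  assumes "a > 0" "b > 0" "c > 0" "k \<ge> 0"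
    and eq: "a\<^sup>2 + b\<^sup>2 + c\<^sup>2 + k * (a * b + b * c + c * a) = (3 * k + 3) * a * b * c"
  defines "d \<equiv> (a\<^sup>2 + k * a * b + b\<^sup>2) div c"
  shows "c dvd a\<^sup>2 + k * a * b + b\<^sup>2" and "d > 0"
    and "a\<^sup>2 + d\<^sup>2 + b\<^sup>2 + k * (a * d + d * b + b * a) = (3 * k + 3) * a * d * b"
proof -
  define e where "e = (3 * k + 3) * a * b - c - k * (a + b)"
  have ce: "a\<^sup>2 + k * a * b + b\<^sup>2 = c * e"
    using eq unfolding e_def by (simp add: algebra_simps power2_eq_square)
  then show "c dvd a\<^sup>2 + k * a * b + b\<^sup>2" by simp
  have de: "d = e" using ce \<open>c > 0\<close> unfolding d_def by simp
  have "k * a * b \<ge> 0" using assms by simp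
  moreover have "a\<^sup>2 > 0" "b\<^sup>2 > 0" using assms by simp_all
  ultimately have "c * e > 0" using ce by linarith
  then show "d > 0" using de \<open>c > 0\<close> by (simp add: zero_less_mult_iff)
  have "a\<^sup>2 + e\<^sup>2 + b\<^sup>2 + k * (a * e + e * b + b * a) - (3 * k + 3) * a * e * b
      = c * e + e * (e + k * (a + b) - (3 * k + 3) * a * b)"
    unfolding ce[symmetric] by (simp add: algebra_simps power2_eq_square)
  also have "\<dots> = 0" unfolding e_def by (simp add: algebra_simps)
  finally show "a\<^sup>2 + d\<^sup>2 + b\<^sup>2 + k * (a * d + d * b + b * a) = (3 * k + 3) * a * d * b"
    using de by simp
qed

lemma MT_invariant:
  assumes "k \<ge> 0" "MT k p = (a, b, c)"
  shows "a > 0 \<and> b > 0 \<and> c > 0 \<and>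
    a\<^sup>2 + b\<^sup>2 + c\<^sup>2 + k * (a * b + b * c + c * a) = (3 * k + 3) * a * b * c"
  using assms(2)
proof (induction p arbitrary: a b c rule: rev_induct)
  case Nil
  then show ?case using \<open>k \<ge> 0\<close>
    by (auto simp: MT_def tree_vertex_def algebra_simps power2_eq_square)
next
  case (snoc d p)
  obtain a' b' c' where p: "MT k p = (a', b', c')" by (metis prod_cases3)
  note IH = snoc.IH[OF p]
  have step: "MT k (p @ [d]) = child (markov_left k) (markov_right k) (MT k p) d"
    by (simp add: MT_def tree_vertex_def)
  show ?case
  proof (cases d)
    case LeftTurn
    then have "a = a'" "b = (a'\<^sup>2 + k * a' * b' + b'\<^sup>2) div c'" "c = b'"
      using step p snoc.prems by auto
    then show ?thesis using markov_step(2,3)[of a' b' c' k] IH \<open>k \<ge> 0\<close> by blast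
  next
    case RightTurn
    then have abc: "a = b'" "b = (b'\<^sup>2 + k * b' * c' + c'\<^sup>2) div a'" "c = c'"
      using step p snoc.prems by auto
    have "b'\<^sup>2 + c'\<^sup>2 + a'\<^sup>2 + k * (b' * c' + c' * a' + a' * b') = (3 * k + 3) * b' * c' * a'"
      using IH by (simp add: algebra_simps)
    then show ?thesis using markov_step(2,3)[of b' c' a' k] IH abc \<open>k \<ge> 0\<close> by blast
  qed
qed

lemma MT_exact:
  assumes "k \<ge> 0" "MT k p = (a, b, c)"
  shows "c dvd a\<^sup>2 + k * a * b + b\<^sup>2" and "a dvd b\<^sup>2 + k * b * c + c\<^sup>2"
proof -
  note inv = MT_invariant[OF assms]
  show "c dvd a\<^sup>2 + k * a * b + b\<^sup>2" using markov_step(1)[of a b c k] inv \<open>k \<ge> 0\<close> by blast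
  have "b\<^sup>2 + c\<^sup>2 + a\<^sup>2 + k * (b * c + c * a + a * b) = (3 * k + 3) * b * c * a"
    using inv by (simp add: algebra_simps)
  then show "a dvd b\<^sup>2 + k * b * c + c\<^sup>2"
    using markov_step(1)[of b c a k] inv \<open>k \<ge> 0\<close> by blast
qed

type_synonym mat22 = "rat^2^2"

definition mat22 :: "rat \<Rightarrow> rat \<Rightarrow> rat \<Rightarrow> rat \<Rightarrow> mat22" where
  "mat22 a b c d = vector [vector [a, b], vector [c, d]]"

fun mm_left :: "mat22 \<times> mat22 \<times> mat22 \<Rightarrow> mat22 \<times> mat22 \<times> mat22" where
  "mm_left (X, Y, Z) = (X, Y ** Z ** matrix_inv Y, Y)"

fun mm_right :: "mat22 \<times> mat22 \<times> mat22 \<Rightarrow> mat22 \<times> mat22 \<times> mat22" where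
  "mm_right (X, Y, Z) = (Y, matrix_inv Y ** X ** Y, Z)"

definition MMT :: "int \<Rightarrow> turn list \<Rightarrow> mat22 \<times> mat22 \<times> mat22" where
  "MMT k = (let K = of_int k in
     tree_vertex
       (mat22 0 1 (-1) (-K),
        mat22 (-K - 1) (K + 2) (-1) 1,
        mat22 (-K - 1) 1 (-K - 2) 1)
       mm_left mm_right)"

definition gc_S :: "int \<Rightarrow> mat22" where
  "gc_S k = (let K = of_int k in mat22 K 0 (3 * K\<^sup>2 + 3 * K) K)"

fun gc_left :: "int \<Rightarrow> mat22 \<times> mat22 \<times> mat22 \<Rightarrow> mat22 \<times> mat22 \<times> mat22" where
  "gc_left k (P, Q, R) = (P, P ** Q - gc_S k, Q)"

fun gc_right :: "int \<Rightarrow> mat22 \<times> mat22 \<times> mat22 \<Rightarrow> mat22 \<times> mat22 \<times> mat22" where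
  "gc_right k (P, Q, R) = (Q, Q ** R - gc_S k, R)"

definition GCT :: "int \<Rightarrow> turn list \<Rightarrow> mat22 \<times> mat22 \<times> mat22" where
  "GCT k = (let K = of_int k in
     tree_vertex
       (mat22 (-K) 1 (-3 * K\<^sup>2 - 3 * K - 1) (3 * K + 3),
        mat22 1 (K + 2) (3 * K + 2) (3 * K\<^sup>2 + 8 * K + 5),
        mat22 1 1 (2 * K + 1) (2 * K + 2))
       (gc_left k) (gc_right k))"

definition M_mat :: "int \<Rightarrow> rat \<Rightarrow> mat22" where
  "M_mat k t = second3 (MMT k (farey_address t))"

definition C_mat :: "int \<Rightarrow> rat \<Rightarrow> mat22" where
  "C_mat k t = second3 (GCT k (farey_address t))"

definition m_num :: "int \<Rightarrow> rat \<Rightarrow> int" where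
  "m_num k t = second3 (MT k (farey_address t))"

definition u_plus :: "int \<Rightarrow> rat \<Rightarrow> int" where
  "u_plus k t = (case MT k (farey_address t) of (m_r, m_t, m_s) \<Rightarrow>
     THE x. 0 < x \<and> x < m_t \<and> [m_r * x = m_s] (mod m_t))"

definition v_minus :: "int \<Rightarrow> rat \<Rightarrow> int" where
  "v_minus k t = (case MT k (farey_address t) of (m_r, m_t, m_s) \<Rightarrow>
     THE x. 0 < x \<and> x < m_t \<and> [m_s * x = - m_r] (mod m_t))"

definition w_num :: "int \<Rightarrow> rat \<Rightarrow> rat" where
  "w_num k t = of_int (u_plus k t * v_minus k t + 1) / of_int (m_num k t)"

end

theory Submission
  imports Defs
begin

text \<open>
  Write \<open>v = u + k\<close>. Every vertex \<open>(X, Y, Z)\<close> of the matrix tree consists of integer matrices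
  \<open>[-v, m; -w, u]\<close> of determinant 1 and trace \<open>-k\<close>, and the product \<open>X Y Z\<close> is
  constant along the tree, equal to \<open>T = [-1, 0; 3k+3, -1]\<close>. Hence both new middle matrices
  have the form \<open>A\<^sup>-\<^sup>1 T B\<^sup>-\<^sup>1\<close>, with \<open>(A, B) = (X, Y)\<close> on the left and
  \<open>(A, B) = (Y, Z)\<close> on the right. The generalized Cohn matrix belonging to \<open>X\<close> is
  \<open>[1, 0; 3k+3, -1] X\<^sup>-\<^sup>1 [1, 0; 0, -1]\<close>, and the recursion \<open>P Q - S\<close> becomes the
  Cayley-Hamilton identity \<open>W + W\<^sup>-\<^sup>1 = -k\<close> for \<open>W = A\<^sup>-\<^sup>1 T B\<^sup>-\<^sup>1\<close>.

  The (1,2) entries of \<open>X Y = T Z\<^sup>-\<^sup>1\<close> and \<open>Y Z = X\<^sup>-\<^sup>1 T\<close> read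
  \<open>m\<^sub>X u\<^sub>Y - v\<^sub>X m\<^sub>Y = m\<^sub>Z\<close> and \<open>m\<^sub>Y u\<^sub>Z - v\<^sub>Y m\<^sub>Z = m\<^sub>X\<close>. They yield
  the two congruences, and also the bounds \<open>0 < u\<^sub>Y\<close> and \<open>v\<^sub>Y < m\<^sub>Y\<close>, given
  \<open>v\<^sub>X \<ge> 0\<close> and \<open>u\<^sub>Z \<le> m\<^sub>Z\<close>, which propagate from the root.
\<close>

section \<open>Arithmetic of 2 by 2 matrices\<close>

abbreviation int_mat22 :: "int \<Rightarrow> int \<Rightarrow> int \<Rightarrow> int \<Rightarrow> mat22" where
  "int_mat22 a b c d \<equiv> mat22 (of_int a) (of_int b) (of_int c) (of_int d)"

lemma mat22_eq_iff:
  "mat22 a b c d = mat22 a' b' c' d' \<longleftrightarrow> a = a' \<and> b = b' \<and> c = c' \<and> d = d'"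
  by (auto simp: mat22_def vec_eq_iff forall_2)

lemma mat22_mult:
  "mat22 a b c d ** mat22 a' b' c' d' =
     mat22 (a * a' + b * c') (a * b' + b * d') (c * a' + d * c') (c * b' + d * d')"
  by (simp add: mat22_def matrix_matrix_mult_def vec_eq_iff forall_2 sum_2)

lemma mat22_diff:
  "mat22 a b c d - mat22 a' b' c' d' = mat22 (a - a') (b - b') (c - c') (d - d')"
  by (simp add: mat22_def vec_eq_iff forall_2)

lemma mat22_one: "mat22 1 0 0 1 = mat 1"
  by (simp add: mat22_def mat_def vec_eq_iff forall_2)

lemma matrix_inv_mat22:
  assumes "a * d - b * c = 1"
  shows "matrix_inv (mat22 a b c d) = mat22 d (- b) (- c) a"
proof -
  let ?A = "mat22 a b c d" and ?B = "mat22 d (- b) (- c) a"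
  have inv: "?A ** ?B = mat 1 \<and> ?B ** ?A = mat 1"
    using assms by (simp add: mat22_mult mat22_one[symmetric] algebra_simps)
  \<comment> \<open>\<open>matrix_inv\<close> is a choice; since \<open>?B\<close> is a two-sided
    inverse, the chosen matrix is one too.\<close>
  then have "?A ** matrix_inv ?A = mat 1"
    using someI[of "\<lambda>B. ?A ** B = mat 1 \<and> B ** ?A = mat 1", OF inv]
    by (simp add: matrix_inv_def)
  then have "?B = ?B ** ?A ** matrix_inv ?A"
    by (simp flip: matrix_mul_assoc)
  then show ?thesis using inv by simp
qed

section \<open>Cohn matrices and the relations within a triple\<close>

definition cohn :: "int \<Rightarrow> int \<Rightarrow> int \<Rightarrow> int \<Rightarrow> mat22" where
  "cohn k u m w = int_mat22 (- (u + k)) m (- w) u"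

definition gen_cohn :: "int \<Rightarrow> int \<Rightarrow> int \<Rightarrow> int \<Rightarrow> mat22" where
  "gen_cohn k u m w =
     int_mat22 u m ((3 * k + 3) * u - w) ((3 * k + 3) * m - (u + k))"

lemma matrix_inv_cohn:
  assumes "m * w = u * (u + k) + 1"
  shows "matrix_inv (cohn k u m w) = int_mat22 u (- m) w (- (u + k))"
proof -
  have "of_int (- (u + k)) * of_int u - of_int m * of_int (- w) = (1 :: rat)"
    using arg_cong[OF assms, of "of_int :: int \<Rightarrow> rat"] by (simp add: algebra_simps)
  from matrix_inv_mat22[OF this] show ?thesis by (simp add: cohn_def)
qed

text \<open>
  The entries \<open>u\<close>, \<open>m\<close>, \<open>w\<close> of \<open>A\<^sup>-\<^sup>1 T B\<^sup>-\<^sup>1\<close>.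
\<close>

definition next_u :: "int \<Rightarrow> int \<Rightarrow> int \<Rightarrow> int \<Rightarrow> int \<Rightarrow> int \<Rightarrow> int \<Rightarrow> int" where
  "next_u k u1 m1 w1 u2 m2 w2 = w1 * m2 + (u1 + k) * ((3 * k + 3) * m2 - (u2 + k))"

definition next_m :: "int \<Rightarrow> int \<Rightarrow> int \<Rightarrow> int \<Rightarrow> int \<Rightarrow> int \<Rightarrow> int \<Rightarrow> int" where
  "next_m k u1 m1 w1 u2 m2 w2 = u1 * m2 + m1 * ((3 * k + 3) * m2 - (u2 + k))"

definition next_w :: "int \<Rightarrow> int \<Rightarrow> int \<Rightarrow> int \<Rightarrow> int \<Rightarrow> int \<Rightarrow> int \<Rightarrow> int" where
  "next_w k u1 m1 w1 u2 m2 w2 = w1 * u2 + (u1 + k) * ((3 * k + 3) * u2 - w2)"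

lemmas next_defs = next_u_def next_m_def next_w_def

text \<open>
  The conditions \<open>p11\<close> to \<open>p22\<close> say \<open>X Y = T Z\<^sup>-\<^sup>1\<close>, and
  \<open>q11\<close> to \<open>q22\<close> say \<open>Y Z = X\<^sup>-\<^sup>1 T\<close>.
\<close>

locale cohn_triple =
  fixes k u1 m1 w1 u2 m2 w2 u3 m3 w3 :: int
  assumes det1: "m1 * w1 = u1 * (u1 + k) + 1"
    and det2: "m2 * w2 = u2 * (u2 + k) + 1"
    and det3: "m3 * w3 = u3 * (u3 + k) + 1"
    and p11: "(u1 + k) * (u2 + k) - m1 * w2 = - u3"
    and p12: "m1 * u2 - (u1 + k) * m2 = m3"
    and p21: "w1 * (u2 + k) - u1 * w2 = (3 * k + 3) * u3 - w3"
    and p22: "u1 * u2 - w1 * m2 = (u3 + k) - (3 * k + 3) * m3"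
    and q11: "(u2 + k) * (u3 + k) - m2 * w3 = - u1 - (3 * k + 3) * m1"
    and q12: "m2 * u3 - (u2 + k) * m3 = m1"
    and q21: "w2 * (u3 + k) - u2 * w3 = - w1 - (3 * k + 3) * (u1 + k)"
    and q22: "u2 * u3 - w2 * m3 = u1 + k"
begin

text \<open>The left side is the negated (1,1) entry of
  \<open>W = X\<^sup>-\<^sup>1 T Y\<^sup>-\<^sup>1\<close>, and \<open>next_u\<close> is its (2,2)
  entry, so this says that \<open>W\<close> has trace \<open>-k\<close>.\<close>

lemma next_trace_left:
  "u1 * u2 + m1 * ((3 * k + 3) * u2 - w2) = next_u k u1 m1 w1 u2 m2 w2 + k"
proof -
  \<comment> \<open>This is the negated trace of
    \<open>T\<^sup>-\<^sup>1 X Y = Z\<^sup>-\<^sup>1\<close>.\<close>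
  have "(u1 * u2 - w1 * m2) + (3 * k + 3) * (m1 * u2 - (u1 + k) * m2)
      + ((u1 + k) * (u2 + k) - m1 * w2) = k"
    unfolding p11 p12 p22 by simp
  then show ?thesis unfolding next_defs by (simp add: algebra_simps)
qed

lemma next_trace_right:
  "u2 * u3 + m2 * ((3 * k + 3) * u3 - w3) = next_u k u2 m2 w2 u3 m3 w3 + k"
proof -
  have "(u2 * u3 - w2 * m3) + (3 * k + 3) * (m2 * u3 - (u2 + k) * m3)
      + ((u2 + k) * (u3 + k) - m2 * w3) = k"
    unfolding q11 q12 q22 by simp
  then show ?thesis unfolding next_defs by (simp add: algebra_simps)
qed

text \<open>Vieta: \<open>m3\<close> and the new entry add up to the sum of the roots of the Markov
  equation, read as a quadratic in \<open>m3\<close>.\<close>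

lemma next_m_left: "next_m k u1 m1 w1 u2 m2 w2 = (3 * k + 3) * m1 * m2 - m3 - k * (m1 + m2)"
  unfolding p12[symmetric] next_defs by (simp add: algebra_simps)

lemma next_m_right: "next_m k u2 m2 w2 u3 m3 w3 = (3 * k + 3) * m2 * m3 - m1 - k * (m2 + m3)"
  unfolding q12[symmetric] next_defs by (simp add: algebra_simps)

end

section \<open>Passing to a child vertex\<close>

lemma cohn_triple_next:
  fixes k u1 m1 w1 u2 m2 w2 :: int
  assumes "m1 * w1 = u1 * (u1 + k) + 1" and "m2 * w2 = u2 * (u2 + k) + 1"
    and tr: "u1 * u2 + m1 * ((3 * k + 3) * u2 - w2) = next_u k u1 m1 w1 u2 m2 w2 + k"
  shows "cohn_triple k u1 m1 w1
    (next_u k u1 m1 w1 u2 m2 w2) (next_m k u1 m1 w1 u2 m2 w2) (next_w k u1 m1 w1 u2 m2 w2)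
    u2 m2 w2"
proof unfold_locales
  let ?u = "next_u k u1 m1 w1 u2 m2 w2" and ?m = "next_m k u1 m1 w1 u2 m2 w2"
    and ?w = "next_w k u1 m1 w1 u2 m2 w2"
  let ?v = "u1 * u2 + m1 * ((3 * k + 3) * u2 - w2)"
  \<comment> \<open>With the determinants kept symbolic, each condition becomes a polynomial
    identity carrying them as factors; \<open>tr\<close> then replaces \<open>?v\<close> by
    \<open>?u + k\<close>.\<close>
  define d1 d2 where "d1 = m1 * w1 - u1 * (u1 + k)" and "d2 = m2 * w2 - u2 * (u2 + k)"
  have d: "d1 = 1" "d2 = 1" using assms(1,2) by (simp_all add: d1_def d2_def)
  have "?m * ?w - ?u * ?v = d1 * d2"
    unfolding next_defs d1_def d2_def by algebra
  then show "?m * ?w = ?u * (?u + k) + 1" using tr d by simp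
  have "(u1 + k) * ?v - m1 * ?w = - (d1 * u2)"
    unfolding next_defs d1_def by algebra
  then show "(u1 + k) * (?u + k) - m1 * ?w = - u2" using tr d by simp
  have "m1 * ?u - (u1 + k) * ?m = d1 * m2"
    unfolding next_defs d1_def by algebra
  then show "m1 * ?u - (u1 + k) * ?m = m2" using d by simp
  have "w1 * ?v - u1 * ?w = d1 * ((3 * k + 3) * u2 - w2)"
    unfolding next_defs d1_def by algebra
  then show "w1 * (?u + k) - u1 * ?w = (3 * k + 3) * u2 - w2" using tr d by simp
  have "u1 * ?u - w1 * ?m = d1 * ((u2 + k) - (3 * k + 3) * m2)"
    unfolding next_defs d1_def by algebra
  then show "u1 * ?u - w1 * ?m = (u2 + k) - (3 * k + 3) * m2" using d by simp
  have "?v * (u2 + k) - ?m * w2 = d2 * (- u1 - (3 * k + 3) * m1)"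
    unfolding next_defs d2_def by algebra
  then show "(?u + k) * (u2 + k) - ?m * w2 = - u1 - (3 * k + 3) * m1" using tr d by simp
  have "?m * u2 - ?v * m2 = d2 * m1"
    unfolding next_defs d2_def by algebra
  then show "?m * u2 - (?u + k) * m2 = m1" using tr d by simp
  have "?w * (u2 + k) - ?u * w2 = d2 * (- w1 - (3 * k + 3) * (u1 + k))"
    unfolding next_defs d2_def by algebra
  then show "?w * (u2 + k) - ?u * w2 = - w1 - (3 * k + 3) * (u1 + k)" using d by simp
  have "?u * u2 - ?w * m2 = d2 * (u1 + k)"
    unfolding next_defs d2_def by algebra
  then show "?u * u2 - ?w * m2 = u1 + k" using d by simp
qed (fact assms)+

text \<open>Put \<open>L = [1, 0; 3k+3, -1]\<close> and \<open>D = [1, 0; 0, -1]\<close>. Then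
  \<open>D L = -T\<close> and \<open>k L D = S\<close>, so the product is
  \<open>-L W D = L W\<^sup>-\<^sup>1 D + S\<close>.\<close>

lemma gen_cohn_step:
  fixes k u1 m1 w1 u2 m2 w2 :: int
  assumes "u1 * u2 + m1 * ((3 * k + 3) * u2 - w2) = next_u k u1 m1 w1 u2 m2 w2 + k"
  shows "gen_cohn k u1 m1 w1 ** gen_cohn k u2 m2 w2 - gc_S k = gen_cohn k
    (next_u k u1 m1 w1 u2 m2 w2) (next_m k u1 m1 w1 u2 m2 w2) (next_w k u1 m1 w1 u2 m2 w2)"
proof -
  have u: "next_u k u1 m1 w1 u2 m2 w2 = u1 * u2 + m1 * ((3 * k + 3) * u2 - w2) - k"
    using assms by simp
  have e22: "((3 * k + 3) * u1 - w1) * m2 +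
      ((3 * k + 3) * m1 - (u1 + k)) * ((3 * k + 3) * m2 - (u2 + k)) - k
    = (3 * k + 3) * next_m k u1 m1 w1 u2 m2 w2 - (next_u k u1 m1 w1 u2 m2 w2 + k)"
    unfolding next_defs by algebra
  have e21: "((3 * k + 3) * u1 - w1) * u2 +
      ((3 * k + 3) * m1 - (u1 + k)) * ((3 * k + 3) * u2 - w2) - (3 * k\<^sup>2 + 3 * k)
    = (3 * k + 3) * next_u k u1 m1 w1 u2 m2 w2 - next_w k u1 m1 w1 u2 m2 w2"
    unfolding u next_w_def by algebra
  have S: "gc_S k = int_mat22 k 0 (3 * k\<^sup>2 + 3 * k) k"
    by (simp add: gc_S_def Let_def)
  show ?thesis
    unfolding gen_cohn_def S mat22_mult mat22_diff e21[symmetric] e22[symmetric]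
    unfolding u next_m_def by simp
qed

context cohn_triple
begin

lemma cohn_mult_left: "cohn k u1 m1 w1 ** cohn k u2 m2 w2 =
    int_mat22 (- u3) m3 ((3 * k + 3) * u3 - w3) ((u3 + k) - (3 * k + 3) * m3)"
proof -
  have "cohn k u1 m1 w1 ** cohn k u2 m2 w2 =
      int_mat22 ((u1 + k) * (u2 + k) - m1 * w2) (m1 * u2 - (u1 + k) * m2)
        (w1 * (u2 + k) - u1 * w2) (u1 * u2 - w1 * m2)"
    by (simp add: cohn_def mat22_mult algebra_simps)
  then show ?thesis unfolding p11 p12 p21 p22 .
qed

lemma cohn_mult_right: "cohn k u2 m2 w2 ** cohn k u3 m3 w3 =
    int_mat22 (- u1 - (3 * k + 3) * m1) m1 (- w1 - (3 * k + 3) * (u1 + k)) (u1 + k)"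
proof -
  have "cohn k u2 m2 w2 ** cohn k u3 m3 w3 =
      int_mat22 ((u2 + k) * (u3 + k) - m2 * w3) (m2 * u3 - (u2 + k) * m3)
        (w2 * (u3 + k) - u2 * w3) (u2 * u3 - w2 * m3)"
    by (simp add: cohn_def mat22_mult algebra_simps)
  then show ?thesis unfolding q11 q12 q21 q22 .
qed

lemma cohn_left: "cohn k u2 m2 w2 ** cohn k u3 m3 w3 ** matrix_inv (cohn k u2 m2 w2) = cohn k
    (next_u k u1 m1 w1 u2 m2 w2) (next_m k u1 m1 w1 u2 m2 w2) (next_w k u1 m1 w1 u2 m2 w2)"
  unfolding cohn_mult_right matrix_inv_cohn[OF det2]
  unfolding cohn_def next_trace_left[symmetric] mat22_mult
  by (simp add: next_defs algebra_simps)

lemma cohn_right: "matrix_inv (cohn k u2 m2 w2) ** cohn k u1 m1 w1 ** cohn k u2 m2 w2 = cohn k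
    (next_u k u2 m2 w2 u3 m3 w3) (next_m k u2 m2 w2 u3 m3 w3) (next_w k u2 m2 w2 u3 m3 w3)"
  unfolding matrix_mul_assoc[symmetric] cohn_mult_left matrix_inv_cohn[OF det2]
  unfolding cohn_def next_trace_right[symmetric] mat22_mult
  by (simp add: next_defs algebra_simps)

lemma middle_bounds:
  assumes "k \<ge> 0" "m1 > 0" "m2 > 0" "m3 > 0" "u1 + k \<ge> 0" "u3 \<le> m3"
  shows "0 < u2" and "u2 + k < m2"
proof -
  have "(u1 + k) * m2 \<ge> 0" using assms by simp
  then have "m1 * u2 > 0" using p12 assms by linarith
  then show "0 < u2" using \<open>m1 > 0\<close> by (simp add: zero_less_mult_iff)
  have "m2 * u3 \<le> m2 * m3" using assms by simp
  then have "(u2 + k) * m3 < m2 * m3" using q12 assms by linarith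
  then show "u2 + k < m2" using \<open>m3 > 0\<close> by simp
qed

end

text \<open>Modulo \<open>a\<close> the product \<open>c * d\<close> is \<open>b\<^sup>2\<close>, a
  unit, so its factor \<open>d\<close> is coprime to \<open>a\<close>; likewise for
  \<open>b\<close>.\<close>

lemma coprime_markov_neighbour:
  fixes a b c d k :: int
  assumes "coprime a b" and "c * d = a\<^sup>2 + k * a * b + b\<^sup>2"
  shows "coprime a d" and "coprime d b"
proof -
  have "b\<^sup>2 + (a + k * b) * a = c * d" "a\<^sup>2 + (k * a + b) * b = c * d"
    using assms(2) by (simp_all add: algebra_simps power2_eq_square)
  then have "gcd a (c * d) = gcd a (b\<^sup>2)" "gcd b (c * d) = gcd b (a\<^sup>2)"
    by (metis add.commute gcd_add_mult)+
  moreover have "coprime a (b\<^sup>2)" "coprime b (a\<^sup>2)"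
    using assms(1) by (simp_all add: coprime_commute)
  ultimately have "coprime a (c * d)" "coprime b (c * d)"
    by (simp_all only: coprime_iff_gcd_eq_1)
  then show "coprime a d" "coprime d b"
    by (simp_all add: coprime_commute)
qed

section \<open>Simultaneous induction along the three trees\<close>

lemma tree_vertex_snoc:
  "tree_vertex x l r (p @ [d]) = child l r (tree_vertex x l r p) d"
  by (simp add: tree_vertex_def)

lemma MT_snoc: "MT k (p @ [d]) = child (markov_left k) (markov_right k) (MT k p) d"
  by (simp add: MT_def tree_vertex_snoc)

lemma MMT_snoc: "MMT k (p @ [d]) = child mm_left mm_right (MMT k p) d"
  by (simp add: MMT_def Let_def tree_vertex_snoc)

lemma GCT_snoc: "GCT k (p @ [d]) = child (gc_left k) (gc_right k) (GCT k p) d"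
  by (simp add: GCT_def Let_def tree_vertex_snoc)

lemma tree_entries:
  assumes "k \<ge> 0"
  shows "\<exists>u1 m1 w1 u2 m2 w2 u3 m3 w3. cohn_triple k u1 m1 w1 u2 m2 w2 u3 m3 w3 \<and>
    MT k p = (m1, m2, m3) \<and>
    MMT k p = (cohn k u1 m1 w1, cohn k u2 m2 w2, cohn k u3 m3 w3) \<and>
    GCT k p = (gen_cohn k u1 m1 w1, gen_cohn k u2 m2 w2, gen_cohn k u3 m3 w3) \<and>
    coprime m1 m2 \<and> coprime m2 m3 \<and> u1 + k \<ge> 0 \<and> u3 \<le> m3"
proof (induction p rule: rev_induct)
  case Nil
  \<comment> \<open>Both outer bounds are equalities at the root (\<open>u1 + k = 0\<close>,
    \<open>u3 = m3 = 1\<close>), hence the non-strict form of the invariant.\<close>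
  have "cohn_triple k (- k) 1 1 1 (k + 2) 1 1 1 (k + 2)"
    by unfold_locales (simp_all add: algebra_simps)
  moreover have "MT k [] = (1, k + 2, 1)"
    by (simp add: MT_def tree_vertex_def)
  moreover have "MMT k [] = (cohn k (- k) 1 1, cohn k 1 (k + 2) 1, cohn k 1 1 (k + 2))"
    by (simp add: MMT_def tree_vertex_def Let_def cohn_def mat22_eq_iff)
  moreover have
    "GCT k [] = (gen_cohn k (- k) 1 1, gen_cohn k 1 (k + 2) 1, gen_cohn k 1 1 (k + 2))"
    by (simp add: GCT_def tree_vertex_def Let_def gen_cohn_def mat22_eq_iff
        algebra_simps power2_eq_square)
  moreover have "coprime 1 (k + 2)" "coprime (k + 2) 1" "- k + k \<ge> 0" "(1 :: int) \<le> 1"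
    by simp_all
  ultimately show ?case by blast
next
  case (snoc d p)
  then obtain u1 m1 w1 u2 m2 w2 u3 m3 w3 where
    triple: "cohn_triple k u1 m1 w1 u2 m2 w2 u3 m3 w3"
    and MT: "MT k p = (m1, m2, m3)"
    and MMT: "MMT k p = (cohn k u1 m1 w1, cohn k u2 m2 w2, cohn k u3 m3 w3)"
    and GCT: "GCT k p = (gen_cohn k u1 m1 w1, gen_cohn k u2 m2 w2, gen_cohn k u3 m3 w3)"
    and cop: "coprime m1 m2" "coprime m2 m3" and bounds: "u1 + k \<ge> 0" "u3 \<le> m3"
    by blast
  interpret cohn_triple k u1 m1 w1 u2 m2 w2 u3 m3 w3 by (fact triple)
  have pos: "m1 > 0" "m2 > 0" "m3 > 0" and markov:
    "m1\<^sup>2 + m2\<^sup>2 + m3\<^sup>2 + k * (m1 * m2 + m2 * m3 + m3 * m1) = (3 * k + 3) * m1 * m2 * m3"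
    using MT_invariant[OF assms MT] by auto
  have mid: "0 < u2" "u2 + k < m2"
    using middle_bounds assms pos bounds by auto
  show ?case
  proof (cases d)
    case LeftTurn
    let ?u = "next_u k u1 m1 w1 u2 m2 w2" and ?m = "next_m k u1 m1 w1 u2 m2 w2"
      and ?w = "next_w k u1 m1 w1 u2 m2 w2"
    \<comment> \<open>The product of the two Vieta roots; it makes the \<open>div\<close> in
      \<open>markov_left\<close> exact.\<close>
    have m: "m3 * ?m = m1\<^sup>2 + k * m1 * m2 + m2\<^sup>2"
      using markov unfolding next_m_left by algebra
    have "cohn_triple k u1 m1 w1 ?u ?m ?w u2 m2 w2"
      by (rule cohn_triple_next[OF det1 det2 next_trace_left])
    moreover have "MT k (p @ [d]) = (m1, ?m, m2)"
      using pos m[symmetric] by (simp add: MT_snoc MT LeftTurn)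
    moreover have "MMT k (p @ [d]) = (cohn k u1 m1 w1, cohn k ?u ?m ?w, cohn k u2 m2 w2)"
      by (simp add: MMT_snoc MMT LeftTurn cohn_left)
    moreover have
      "GCT k (p @ [d]) = (gen_cohn k u1 m1 w1, gen_cohn k ?u ?m ?w, gen_cohn k u2 m2 w2)"
      by (simp add: GCT_snoc GCT LeftTurn gen_cohn_step[OF next_trace_left])
    moreover note coprime_markov_neighbour[OF cop(1) m] bounds(1)
    moreover have "u2 \<le> m2" using mid assms by simp
    ultimately show ?thesis by blast
  next
    case RightTurn
    let ?u = "next_u k u2 m2 w2 u3 m3 w3" and ?m = "next_m k u2 m2 w2 u3 m3 w3"
      and ?w = "next_w k u2 m2 w2 u3 m3 w3"
    have m: "m1 * ?m = m2\<^sup>2 + k * m2 * m3 + m3\<^sup>2"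
      using markov unfolding next_m_right by algebra
    have "cohn_triple k u2 m2 w2 ?u ?m ?w u3 m3 w3"
      by (rule cohn_triple_next[OF det2 det3 next_trace_right])
    moreover have "MT k (p @ [d]) = (m2, ?m, m3)"
      using pos m[symmetric] by (simp add: MT_snoc MT RightTurn)
    moreover have "MMT k (p @ [d]) = (cohn k u2 m2 w2, cohn k ?u ?m ?w, cohn k u3 m3 w3)"
      by (simp add: MMT_snoc MMT RightTurn cohn_right)
    moreover have
      "GCT k (p @ [d]) = (gen_cohn k u2 m2 w2, gen_cohn k ?u ?m ?w, gen_cohn k u3 m3 w3)"
      by (simp add: GCT_snoc GCT RightTurn gen_cohn_step[OF next_trace_right])
    moreover note coprime_markov_neighbour[OF cop(2) m] bounds(2)
    moreover have "u2 + k \<ge> 0" using mid assms by simp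
    ultimately show ?thesis by blast
  qed
qed

section \<open>Residues modulo the middle Markov number\<close>

lemma the_residue_eq:
  fixes a b m x :: int
  assumes "coprime a m" and "0 < x" "x < m" and "[a * x = b] (mod m)"
  shows "(THE x. 0 < x \<and> x < m \<and> [a * x = b] (mod m)) = x"
proof (rule the_equality)
  fix y assume y: "0 < y \<and> y < m \<and> [a * y = b] (mod m)"
  then have "[a * y = a * x] (mod m)"
    using assms(4) cong_sym cong_trans by blast
  then have "[y = x] (mod m)"
    using assms(1) by (simp add: cong_mult_lcancel)
  then show "y = x"
    using y assms by (simp add: cong_def)
qed (use assms in simp)

theorem theorem7p27:
  fixes k :: int and t :: rat
  assumes "k \<ge> 0" and "0 < t" and "t < 1"
  shows "M_mat k t =
           mat22 (- of_int (v_minus k t)) (of_int (m_num k t))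
                 (- w_num k t)            (of_int (u_plus k t))
       \<and> C_mat k t =
           mat22 (of_int (u_plus k t)) (of_int (m_num k t))
                 ((3 * of_int k + 3) * of_int (u_plus k t) - w_num k t)
                 ((3 * of_int k + 3) * of_int (m_num k t) - of_int (v_minus k t))"
proof -
  obtain u1 m1 w1 u2 m2 w2 u3 m3 w3 where
    triple: "cohn_triple k u1 m1 w1 u2 m2 w2 u3 m3 w3"
    and MT: "MT k (farey_address t) = (m1, m2, m3)"
    and MMT: "MMT k (farey_address t) = (cohn k u1 m1 w1, cohn k u2 m2 w2, cohn k u3 m3 w3)"
    and GCT: "GCT k (farey_address t) =
      (gen_cohn k u1 m1 w1, gen_cohn k u2 m2 w2, gen_cohn k u3 m3 w3)"
    and cop: "coprime m1 m2" "coprime m2 m3" and bounds: "u1 + k \<ge> 0" "u3 \<le> m3"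
    using tree_entries[OF assms(1)] by blast
  interpret cohn_triple k u1 m1 w1 u2 m2 w2 u3 m3 w3 by (fact triple)
  have pos: "m1 > 0" "m2 > 0" "m3 > 0"
    using MT_invariant[OF assms(1) MT] by auto
  have mid: "0 < u2" "u2 + k < m2"
    using middle_bounds assms(1) pos bounds by auto
  have "m1 * u2 - m3 = m2 * (u1 + k)" "m3 * (u2 + k) - - m1 = m2 * u3"
    using p12 q12 by (simp_all add: algebra_simps)
  then have cong: "[m1 * u2 = m3] (mod m2)" "[m3 * (u2 + k) = - m1] (mod m2)"
    by (simp_all only: cong_iff_dvd_diff dvd_triv_left)
  have u: "u_plus k t = u2"
    using the_residue_eq[OF cop(1) _ _ cong(1)] mid assms(1) by (simp add: u_plus_def MT)
  have v: "v_minus k t = u2 + k"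
    using the_residue_eq[OF _ _ _ cong(2)] cop(2) mid assms(1)
    by (simp add: v_minus_def MT coprime_commute)
  have m: "m_num k t = m2" by (simp add: m_num_def MT)
  have w: "w_num k t = of_int w2"
    \<comment> \<open>By \<open>det2\<close> the numerator is \<open>m2 * w2\<close>, so the
      quotient is the integer \<open>w2\<close>.\<close>
    unfolding w_num_def u v m det2[symmetric] using pos by simp
  show ?thesis
    by (simp add: M_mat_def C_mat_def MMT GCT u v m w cohn_def gen_cohn_def)
qed

end
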